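(* Let $b=\langle b(n):n<\omega\rangle$ be a sequence of non-empty sets and let $h\in\omega^\omega$ satisfy $0<h(n)<|b(n)|$ for all $n<\omega$. If $h$ does not diverge to infinity, then $\mathfrak{d}^{\mathrm{Lc}}_{b,h}\geq\mathfrak{c}$ and $\mathfrak{b}^{\mathrm{Lc}}_{b,h}=N+1$, where $N$ is the least natural number such that $A_N:=\{n<\omega: h(n)=N\}$ is infinite. Moreover, $\mathfrak{d}^{\mathrm{Lc}}_{b,h}=\mathfrak{c}$ when $|b(n)|\leq\mathfrak{c}$ for all but finitely many $n<\omega$.
   Context: For a sequence $b$ of non-empty sets and $h\in\omega^\omega$, let $\prod b=\prod_{n<\omega}b(n)$ and $\mathcal{S}(b,h)=\prod_{n<\omega}[b(n)]^{\leq h(n)}$ (slaloms). For $x\in\prod b$ and $\varphi\in\mathcal{S}(b,h)$ write $x\in^*\varphi$ iff $x(n)\in\varphi(n)$ for all but finitely many $n$. The localization cardinals are: $\mathfrak{b}^{\mathrm{Lc}}_{b,h}$ = the least size of a set $F\subseteq\prod b$ such that no single $\varphi\in\mathcal{S}(b,h)$ satisfies $x\in^*\varphi$ for all $x\in F$; $\mathfrak{d}^{\mathrm{Lc}}_{b,h}$ = the least size of a set $D\subseteq\mathcal{S}(b,h)$ such that every $x\in\prod b$ satisfies $x\in^*\varphi$ for some $\varphi\in D$. $\mathfrak{c}=2^{\aleph_0}$. *)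

theory Defs
  imports Complex_Main "HOL-Library.FuncSet"
begin

unbundle cardinal_syntax

definition prod_seq :: "(nat \<Rightarrow> 'a set) \<Rightarrow> (nat \<Rightarrow> 'a) set" where
  "prod_seq b = (\<Pi> n\<in>UNIV. b n)"

definition slaloms :: "(nat \<Rightarrow> 'a set) \<Rightarrow> (nat \<Rightarrow> nat) \<Rightarrow> (nat \<Rightarrow> 'a set) set" where
  "slaloms b h = (\<Pi> n\<in>UNIV. {A. A \<subseteq> b n \<and> finite A \<and> card A \<le> h n})"

definition localized :: "(nat \<Rightarrow> 'a) \<Rightarrow> (nat \<Rightarrow> 'a set) \<Rightarrow> bool" (infix \<open>\<in>\<^sup>*\<close> 50) where
  "x \<in>\<^sup>* \<phi> \<longleftrightarrow> (\<forall>\<^sub>\<infinity>n. x n \<in> \<phi> n)"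

text \<open>The least cardinality of a member of a family of sets. A cardinal is a cardinal
  order, determined only up to \<open>=o\<close>, so any member of minimal size may serve as its
  representative. The value is meaningful only for a nonempty family.\<close>

definition least_size :: "'a set set \<Rightarrow> 'a rel" where
  "least_size \<A> = |SOME A. A \<in> \<A> \<and> (\<forall>B\<in>\<A>. |A| \<le>o |B| )|"

lemma least_size:
  assumes "\<A> \<noteq> {}"
  shows "\<exists>A\<in>\<A>. least_size \<A> = |A|" and "\<forall>B\<in>\<A>. least_size \<A> \<le>o |B|"
proof -
  have "\<exists>r\<in>card_of ` \<A>. \<forall>r'\<in>card_of ` \<A>. r \<le>o r'"
    using assms by (intro exists_minim_Card_order) (auto simp: card_of_Card_order)
  then have "\<exists>A. A \<in> \<A> \<and> (\<forall>B\<in>\<A>. |A| \<le>o |B| )" by blast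
  from someI_ex[OF this] show "\<exists>A\<in>\<A>. least_size \<A> = |A|" "\<forall>B\<in>\<A>. least_size \<A> \<le>o |B|"
    unfolding least_size_def by blast+
qed

definition bLc :: "(nat \<Rightarrow> 'a set) \<Rightarrow> (nat \<Rightarrow> nat) \<Rightarrow> (nat \<Rightarrow> 'a) rel" where
  "bLc b h = least_size
     {F. F \<subseteq> prod_seq b \<and> \<not> (\<exists>\<phi>\<in>slaloms b h. \<forall>x\<in>F. x \<in>\<^sup>* \<phi>)}"

definition dLc :: "(nat \<Rightarrow> 'a set) \<Rightarrow> (nat \<Rightarrow> nat) \<Rightarrow> (nat \<Rightarrow> 'a set) rel" where
  "dLc b h = least_size
     {D. D \<subseteq> slaloms b h \<and> (\<forall>x\<in>prod_seq b. \<exists>\<phi>\<in>D. x \<in>\<^sup>* \<phi>)}"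

text \<open>Under the hypotheses usual for localization, both families are nonempty, so that
  \<open>bLc\<close> and \<open>dLc\<close> are genuine minima: the whole product is never localized by one
  slalom, and the set of all slaloms localizes everything.\<close>

lemma bLc_family_nonempty:
  assumes "\<And>n. |{..<h n}| <o |b n|"
  shows "\<not> (\<exists>\<phi>\<in>slaloms b h. \<forall>x\<in>prod_seq b. x \<in>\<^sup>* \<phi>)"
proof
  assume "\<exists>\<phi>\<in>slaloms b h. \<forall>x\<in>prod_seq b. x \<in>\<^sup>* \<phi>"
  then obtain \<phi> where \<phi>: "\<phi> \<in> slaloms b h" "\<And>x. x \<in> prod_seq b \<Longrightarrow> x \<in>\<^sup>* \<phi>" by blast
  have "\<exists>y. y \<in> b n \<and> y \<notin> \<phi> n" for n
  proof (rule ccontr)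
    assume "\<not> (\<exists>y. y \<in> b n \<and> y \<notin> \<phi> n)"
    with \<phi>(1) have "b n = \<phi> n" "finite (\<phi> n)" "card (\<phi> n) \<le> h n"
      by (auto simp: slaloms_def Pi_iff)
    then have "|b n| \<le>o |{..<h n}|"
      by (auto simp flip: card_of_ordLeq simp: inj_on_iff_card_le)
    with assms[of n] show False using not_ordLess_ordLeq by blast
  qed
  then obtain x where x: "\<And>n. x n \<in> b n \<and> x n \<notin> \<phi> n" by metis
  then have "x \<in>\<^sup>* \<phi>" by (intro \<phi>(2)) (auto simp: prod_seq_def)
  with x show False by (simp add: localized_def)
qed

lemma dLc_family_nonempty:
  assumes "\<And>n. 0 < h n"
  shows "\<forall>x\<in>prod_seq b. \<exists>\<phi>\<in>slaloms b h. x \<in>\<^sup>* \<phi>"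
proof
  fix x assume "x \<in> prod_seq b"
  then have "(\<lambda>n. {x n}) \<in> slaloms b h"
    using assms by (auto simp: slaloms_def prod_seq_def Suc_le_eq)
  moreover have "x \<in>\<^sup>* (\<lambda>n. {x n})" by (simp add: localized_def)
  ultimately show "\<exists>\<phi>\<in>slaloms b h. x \<in>\<^sup>* \<phi>" by blast
qed

definition continuum :: "(nat \<Rightarrow> bool) rel" where
  "continuum = ctwo ^c natLeq"

end

theory Submission
  imports Defs "HOL-Library.Countable" "HOL-Library.Infinite_Set"
begin

text \<open>
  Let \<open>N\<close> be the least value that \<open>h\<close> takes infinitely often, on the infinite set \<open>A\<close>. Since
  \<open>h \<ge> N\<close> almost everywhere, any \<open>N\<close> functions are localized by a single slalom. Conversely, an
  independent family of functions \<open>A \<rightarrow> {0..N}\<close> of size continuum transfers to \<open>\<Prod>b\<close>; any \<open>N + 1\<close>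
  of its members take \<open>N + 1\<close> different values simultaneously at infinitely many points of \<open>A\<close>, so
  every slalom localizes at most \<open>N\<close> of them. Hence \<open>\<bb> = N + 1\<close>, and a family of slaloms
  localizing everything covers a set of size continuum by finite pieces, so \<open>\<dd> \<ge> \<cc>\<close>.
\<close>

section \<open>Independent families of functions on an infinite set\<close>

text \<open>Each pair of distinct functions in \<open>I\<close> differs at some point;
  \<open>K\<close> bounds the finitely many points chosen.\<close>

lemma eventually_inj_on_initial_segments:
  assumes "finite I"
  shows "\<exists>K. \<forall>k\<ge>K. inj_on (\<lambda>f :: nat \<Rightarrow> 'a. map f [0..<k]) I"
proof -
  obtain d where d: "\<And>f g :: nat \<Rightarrow> 'a. f \<noteq> g \<Longrightarrow> f (d f g) \<noteq> g (d f g)"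
    by (metis ext)
  have "finite ((\<lambda>(f, g). d f g) ` (I \<times> I))" using assms by blast
  then obtain K where K: "\<And>f g. f \<in> I \<Longrightarrow> g \<in> I \<Longrightarrow> d f g < K"
    unfolding finite_nat_set_iff_bounded by fastforce
  have "inj_on (\<lambda>f. map f [0..<k]) I" if "k \<ge> K" for k
  proof (rule inj_onI, rule ccontr)
    fix f g assume fg: "f \<in> I" "g \<in> I" "map f [0..<k] = map g [0..<k]" "f \<noteq> g"
    have "d f g < k" using K fg that by fastforce
    moreover have "\<forall>j<k. f j = g j" using fg(3) by auto
    ultimately show False using d fg(4) by blast
  qed
  then show ?thesis by blast
qed

text \<open>Decoding the index of a point in the enumeration of \<open>A\<close> maps
  \<open>A\<close> onto the countable type, and a finite set has no infinite image.\<close>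

lemma infinite_fibre_coding:
  fixes A :: "nat set"
  assumes "infinite A"
  shows "\<exists>c :: nat \<Rightarrow> 'i::countable. \<forall>S. infinite S \<longrightarrow> infinite {n\<in>A. c n \<in> S}"
proof -
  define e where "e = enumerate A"
  have e: "inj e" "range e = A"
    using bij_enumerate[OF assms] by (simp_all add: e_def bij_betw_def)
  define c :: "nat \<Rightarrow> 'i" where "c n = from_nat (inv e n)" for n
  have "infinite {n\<in>A. c n \<in> S}" if "infinite S" for S
  proof -
    have "S \<subseteq> c ` {n\<in>A. c n \<in> S}"
    proof
      fix s assume "s \<in> S"
      have "c (e (to_nat s)) = s" by (simp add: c_def e(1))
      moreover have "e (to_nat s) \<in> A" using e(2) by blast
      ultimately show "s \<in> c ` {n\<in>A. c n \<in> S}"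
        using \<open>s \<in> S\<close> by (intro image_eqI[of _ _ "e (to_nat s)"]) simp_all
    qed
    with that show ?thesis by (meson finite_imageI finite_subset)
  qed
  then show ?thesis by blast
qed

text \<open>The classical construction of an independent family: a point of \<open>A\<close> codes a level \<open>k\<close>
  together with a finite table assigning values to binary words, which is looked up at the
  restriction of \<open>f\<close> to \<open>k\<close>.\<close>

lemma independent_family:
  assumes "infinite A"
  shows "\<exists>X :: (nat \<Rightarrow> bool) \<Rightarrow> nat \<Rightarrow> nat.
    \<forall>I s. finite I \<longrightarrow> infinite {n\<in>A. \<forall>f\<in>I. X f n = s f}"
proof -
  obtain c :: "nat \<Rightarrow> nat \<times> (bool list \<times> nat) list"
    where c: "\<And>S. infinite S \<Longrightarrow> infinite {n\<in>A. c n \<in> S}"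
    using infinite_fibre_coding[OF assms] by blast
  \<comment> \<open>A word missing from the table yields the unspecified value
    \<open>the None\<close>. This is harmless: the tables used below list every word looked up for
    \<open>f\<close> in \<open>I\<close>.\<close>
  define X :: "(nat \<Rightarrow> bool) \<Rightarrow> nat \<Rightarrow> nat" where
    "X f n = the (map_of (snd (c n)) (map f [0..<fst (c n)]))" for f n
  have "infinite {n\<in>A. \<forall>f\<in>I. X f n = s f}" if fin: "finite I" for I s
  proof -
    obtain K where K: "\<And>k. k \<ge> K \<Longrightarrow> inj_on (\<lambda>f :: nat \<Rightarrow> bool. map f [0..<k]) I"
      using eventually_inj_on_initial_segments[OF fin] by blast
    obtain fs where fs: "set fs = I" "distinct fs" using finite_distinct_list[OF fin] by blast
    \<comment> \<open>The table prescribing \<open>s\<close> on \<open>I\<close> at level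
      \<open>k\<close>. From \<open>K\<close> on its keys are distinct, so lookup is unambiguous;
      the component \<open>k\<close> makes these codes infinitely many.\<close>
    define p where "p k = (k, map (\<lambda>f. (map f [0..<k], s f)) fs)" for k
    have "inj_on p {K..}" by (rule inj_onI) (simp add: p_def)
    then have "infinite (p ` {K..})" by (simp add: finite_image_iff infinite_Ici)
    moreover have "X f n = s f" if "c n \<in> p ` {K..}" "f \<in> I" for f n
    proof -
      obtain k where k: "k \<ge> K" "c n = p k" using \<open>c n \<in> p ` {K..}\<close> by auto
      have "distinct (map fst (snd (p k)))"
        using fs K[OF k(1)] by (simp add: p_def distinct_map comp_def)
      moreover have "(map f [0..<k], s f) \<in> set (snd (p k))"
        using \<open>f \<in> I\<close> fs by (auto simp: p_def)
      ultimately have "map_of (snd (p k)) (map f [0..<k]) = Some (s f)" by simp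
      then show ?thesis by (simp add: X_def k(2)) (simp add: p_def)
    qed
    ultimately have "infinite {n\<in>A. c n \<in> p ` {K..}}"
      and "{n\<in>A. c n \<in> p ` {K..}} \<subseteq> {n\<in>A. \<forall>f\<in>I. X f n = s f}"
      using c by blast+
    then show ?thesis by (rule contrapos_nn[OF _ finite_subset])
  qed
  then show ?thesis by blast
qed

section \<open>Transfer of the independent family to the product\<close>

lemma card_of_ordLeq_iff_card_le:
  assumes "finite A" "finite B"
  shows "|A| \<le>o |B| \<longleftrightarrow> card A \<le> card B"
  unfolding card_of_ordLeq[symmetric] using assms by (rule inj_on_iff_card_le)

lemma card_of_finite_ordLeq_infinite:
  assumes "finite A" "infinite B"
  shows "|A| \<le>o |B|"
  using assms card_of_ordLeq_finite ordLeq_total[OF card_of_Well_order[of A] card_of_Well_order[of B]]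
  by blast

lemma infinite_UNIV_nat_bool: "infinite (UNIV :: (nat \<Rightarrow> bool) set)"
proof
  assume "finite (UNIV :: (nat \<Rightarrow> bool) set)"
  then have "finite (UNIV :: nat set)" by (rule finite_fun_UNIVD1) simp
  then show False by simp
qed

text \<open>If one slalom localized \<open>N + 1\<close> members, independence would give a point
  \<open>n\<close> with \<open>h n = N\<close> where these members take \<open>N + 1\<close>
  distinct values, all in \<open>\<phi> n\<close>.\<close>

lemma family_finitely_localized:
  fixes b :: "nat \<Rightarrow> 'a set" and h :: "nat \<Rightarrow> nat"
  assumes big: "\<And>n. |{..<h n}| <o |b n|" and inf: "infinite {n. h n = N}"
  shows "\<exists>X :: (nat \<Rightarrow> bool) \<Rightarrow> nat \<Rightarrow> 'a. range X \<subseteq> prod_seq b \<and>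
    (\<forall>\<phi>\<in>slaloms b h. finite {f. X f \<in>\<^sup>* \<phi>} \<and> card {f. X f \<in>\<^sup>* \<phi>} \<le> N)"
proof -
  \<comment> \<open>The strict inequality in \<open>big\<close> leaves room for one point more than
    \<open>h n\<close>.\<close>
  have "\<exists>u. inj_on u {..h n} \<and> u ` {..h n} \<subseteq> b n" for n
  proof -
    have "|{..h n}| \<le>o |b n|"
    proof (cases "finite (b n)")
      case True
      then have "\<not> card (b n) \<le> h n"
        using big[of n] not_ordLess_ordLeq card_of_ordLeq_iff_card_le[of "b n" "{..<h n}"] by auto
      then show ?thesis using True by (simp add: card_of_ordLeq_iff_card_le)
    next
      case False
      then show ?thesis by (simp add: card_of_finite_ordLeq_infinite)
    qed
    then show ?thesis unfolding card_of_ordLeq[symmetric] .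
  qed
  then obtain u where u: "\<And>n. inj_on (u n) {..h n}" "\<And>n. u n ` {..h n} \<subseteq> b n" by metis
  obtain Y :: "(nat \<Rightarrow> bool) \<Rightarrow> nat \<Rightarrow> nat"
    where Y: "\<And>I s. finite I \<Longrightarrow> infinite {n\<in>{n. h n = N}. \<forall>f\<in>I. Y f n = s f}"
    using independent_family[OF inf] by blast
  \<comment> \<open>\<open>Y\<close> may be unbounded, while \<open>u n\<close> is controlled only
    up to \<open>h n\<close>. The truncation changes nothing where \<open>h n = N\<close> and the
    prescribed value is at most \<open>N\<close>.\<close>
  define X where "X f n = u n (min (Y f n) (h n))" for f n
  have "range X \<subseteq> prod_seq b" using u(2) by (fastforce simp: X_def prod_seq_def)
  moreover have False
    if \<phi>: "\<phi> \<in> slaloms b h" and I: "I \<subseteq> {f. X f \<in>\<^sup>* \<phi>}" "finite I" "card I = N + 1" for \<phi> I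
  proof -
    obtain s where s: "bij_betw s I {..N}"
      using I by (metis Suc_eq_plus1 card_atMost finite_atMost finite_same_card_bij)
    have "\<forall>\<^sub>\<infinity>n. \<forall>f\<in>I. X f n \<in> \<phi> n"
      using I by (auto simp: localized_def eventually_ball_finite_distrib)
    moreover have "\<exists>\<^sub>\<infinity>n. h n = N \<and> (\<forall>f\<in>I. Y f n = s f)"
      using Y[OF I(2), of s] by (simp add: frequently_cofinite)
    ultimately have "\<exists>\<^sub>\<infinity>n. (\<forall>f\<in>I. X f n \<in> \<phi> n) \<and> h n = N \<and> (\<forall>f\<in>I. Y f n = s f)"
      using frequently_eventually_conj by fast
    then obtain n where n: "\<forall>f\<in>I. X f n \<in> \<phi> n" "h n = N" "\<forall>f\<in>I. Y f n = s f"
      by (auto dest: frequently_ex)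
    have "u n i \<in> \<phi> n" if "i \<le> N" for i
    proof -
      have "i \<in> s ` I" using s \<open>i \<le> N\<close> by (simp add: bij_betw_def)
      then obtain f where "f \<in> I" "s f = i" by blast
      then show ?thesis using n that by (force simp: X_def)
    qed
    then have "u n ` {..N} \<subseteq> \<phi> n" by auto
    moreover have "finite (\<phi> n)" "card (\<phi> n) \<le> N"
      using \<phi> n(2) by (auto simp: slaloms_def Pi_iff)
    moreover have "card (u n ` {..N}) = N + 1" using u(1)[of n] n(2) by (simp add: card_image)
    ultimately show False by (metis Suc_eq_plus1 card_mono le_trans not_less_eq_eq order_refl)
  qed
  then have "finite {f. X f \<in>\<^sup>* \<phi>} \<and> card {f. X f \<in>\<^sup>* \<phi>} \<le> N" if "\<phi> \<in> slaloms b h" for \<phi>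
    using that infinite_arbitrarily_large[of "{f. X f \<in>\<^sup>* \<phi>}" "N + 1"]
      obtain_subset_with_card_n[of "N + 1" "{f. X f \<in>\<^sup>* \<phi>}"]
    by (metis Suc_eq_plus1 not_less_eq_eq)
  ultimately show ?thesis by blast
qed

section \<open>Bounds for \<open>dLc\<close> by the continuum\<close>

lemma continuum_ordIso: "continuum =o |UNIV :: (nat \<Rightarrow> bool) set|"
proof -
  have "Func UNIV UNIV = (UNIV :: (nat \<Rightarrow> bool) set)" by (auto simp: Func_def)
  then show ?thesis
    by (simp add: continuum_def cexp_def ctwo_def Field_natLeq Field_card_of card_of_refl)
qed

lemma localizing_family_ge_continuum:
  assumes big: "\<And>n. |{..<h n}| <o |b n|" and inf: "infinite {n. h n = N}"
    and D: "D \<subseteq> slaloms b h" "\<forall>x\<in>prod_seq b. \<exists>\<phi>\<in>D. x \<in>\<^sup>* \<phi>"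
  shows "continuum \<le>o |D|"
proof -
  obtain X where X: "range X \<subseteq> prod_seq b"
    "\<And>\<phi>. \<phi> \<in> slaloms b h \<Longrightarrow> finite {f :: nat \<Rightarrow> bool. X f \<in>\<^sup>* \<phi>}"
    using family_finitely_localized[OF big inf] by blast
  have cover: "UNIV = (\<Union>\<phi>\<in>D. {f. X f \<in>\<^sup>* \<phi>})" using X(1) D(2) by blast
  \<comment> \<open>The bound on the size of a union of small sets requires an infinite index
    set.\<close>
  have "infinite D"
  proof
    assume "finite D"
    then have "finite (\<Union>\<phi>\<in>D. {f. X f \<in>\<^sup>* \<phi>})" using X(2) D(1) by blast
    then show False using infinite_UNIV_nat_bool unfolding cover by blast
  qed
  then have "|UNIV :: (nat \<Rightarrow> bool) set| \<le>o |D|"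
    unfolding cover using X(2) D(1)
    by (intro card_of_UNION_ordLeq_infinite)
      (auto intro: card_of_finite_ordLeq_infinite card_of_mono1)
  then show ?thesis using continuum_ordIso ordIso_ordLeq_trans by blast
qed

text \<open>Singleton slaloms suffice, and modifying finitely many coordinates does not affect
  \<open>\<in>\<^sup>*\<close>. Freezing the coordinates below \<open>m\<close>, where
  \<open>b n\<close> may be too large, leaves at most continuum many slaloms.\<close>

lemma localizing_family_le_continuum:
  assumes ne: "\<And>n. b n \<noteq> {}" and pos: "\<And>n. 0 < h n"
    and small: "\<forall>\<^sub>\<infinity>n. |b n| \<le>o continuum"
  shows "\<exists>D\<subseteq>slaloms b h. (\<forall>x\<in>prod_seq b. \<exists>\<phi>\<in>D. x \<in>\<^sup>* \<phi>) \<and> |D| \<le>o continuum"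
proof -
  obtain m where m: "\<And>n. n \<ge> m \<Longrightarrow> |b n| \<le>o continuum"
    using small by (auto simp: cofinite_eq_sequentially eventually_sequentially)
  have "\<exists>v :: 'a \<Rightarrow> nat \<Rightarrow> bool. n \<ge> m \<longrightarrow> inj_on v (b n)" for n
    using ordLeq_ordIso_trans[OF m continuum_ordIso, of n] by (auto simp flip: card_of_ordLeq)
  then obtain v :: "nat \<Rightarrow> 'a \<Rightarrow> nat \<Rightarrow> bool" where v: "\<And>n. n \<ge> m \<Longrightarrow> inj_on (v n) (b n)"
    by metis
  obtain e where e: "\<And>n. e n \<in> b n" using ne by (meson equals0I)
  define S where "S x n = {if n < m then e n else x n}" for x n
  define D where "D = S ` prod_seq b"
  have "D \<subseteq> slaloms b h"
    using e pos by (auto simp: D_def S_def slaloms_def prod_seq_def Suc_le_eq)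
  moreover have "x \<in>\<^sup>* S x" for x
    by (auto simp: localized_def S_def cofinite_eq_sequentially eventually_sequentially
        intro!: exI[of _ m])
  then have "\<forall>x\<in>prod_seq b. \<exists>\<phi>\<in>D. x \<in>\<^sup>* \<phi>" by (auto simp: D_def)
  moreover have "|D| \<le>o continuum"
  proof -
    \<comment> \<open>The binary codes of all coordinates are merged into one binary sequence by
      pairing. Below \<open>m\<close> the code need not be injective, but there all members of
      \<open>D\<close> agree.\<close>
    define J where "J \<phi> k = (case from_nat k of (i, j) \<Rightarrow> v i (the_elem (\<phi> i)) j)"
      for \<phi> :: "nat \<Rightarrow> 'a set" and k :: nat
    have "inj_on J D"
    proof (rule inj_onI)
      fix \<phi> \<psi> assume "\<phi> \<in> D" "\<psi> \<in> D" and J: "J \<phi> = J \<psi>"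
      then obtain x y where xy: "x \<in> prod_seq b" "\<phi> = S x" "y \<in> prod_seq b" "\<psi> = S y"
        by (auto simp: D_def)
      have "x i = y i" if "i \<ge> m" for i
      proof -
        have "v i (x i) = v i (y i)"
        proof
          fix j show "v i (x i) j = v i (y i) j"
          using fun_cong[OF J, of "to_nat (i, j)"] that by (simp add: J_def xy S_def)
        qed
        moreover have "x i \<in> b i" "y i \<in> b i" using xy by (auto simp: prod_seq_def)
        ultimately show ?thesis using v[OF that] by (meson inj_onD)
      qed
      then show "\<phi> = \<psi>" by (auto simp: xy S_def fun_eq_iff)
    qed
    then have "|D| \<le>o |UNIV :: (nat \<Rightarrow> bool) set|" by (auto simp flip: card_of_ordLeq)
    then show ?thesis using continuum_ordIso ordIso_symmetric ordLeq_ordIso_trans by blast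
  qed
  ultimately show ?thesis by blast
qed

section \<open>The value of \<open>bLc\<close>\<close>

text \<open>The slalom collects all values of \<open>F\<close> at \<open>n\<close>, and is empty at
  the finitely many \<open>n\<close> where these might be too many.\<close>

lemma localized_if_card_le:
  assumes "F \<subseteq> prod_seq b" "finite F" "\<forall>\<^sub>\<infinity>n. card F \<le> h n"
  shows "\<exists>\<phi>\<in>slaloms b h. \<forall>x\<in>F. x \<in>\<^sup>* \<phi>"
proof
  define \<phi> where "\<phi> n = (if card F \<le> h n then (\<lambda>x. x n) ` F else {})" for n
  show "\<phi> \<in> slaloms b h"
    using assms(1,2)
    by (fastforce simp: slaloms_def \<phi>_def prod_seq_def split: if_splits
        intro: order_trans[OF card_image_le])
  show "\<forall>x\<in>F. x \<in>\<^sup>* \<phi>"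
    using assms(3) by (auto simp: localized_def \<phi>_def elim: eventually_mono)
qed

text \<open>If all fibres of \<open>h\<close> were finite, \<open>h\<close> would eventually exceed
  every bound. Below the least infinite fibre only finitely many finite ones remain.\<close>

lemma least_infinite_fibre:
  fixes h :: "nat \<Rightarrow> nat"
  assumes "\<not> filterlim h at_top sequentially"
  shows "\<exists>N. infinite {n. h n = N} \<and> (\<forall>M. infinite {n. h n = M} \<longrightarrow> N \<le> M)
    \<and> (\<forall>\<^sub>\<infinity>n. N \<le> h n)"
proof -
  have finite_below: "\<forall>\<^sub>\<infinity>n. K \<le> h n" if "\<And>M. M < K \<Longrightarrow> finite {n. h n = M}" for K
  proof -
    have "{n. \<not> K \<le> h n} = (\<Union>M<K. {n. h n = M})" by auto
    then show ?thesis using that by (simp add: eventually_cofinite)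
  qed
  have "\<exists>N. infinite {n. h n = N}"
    using assms finite_below by (auto simp: filterlim_at_top cofinite_eq_sequentially)
  then obtain N where N: "infinite {n. h n = N}" "\<And>M. M < N \<Longrightarrow> finite {n. h n = M}"
    using exists_least_iff[of "\<lambda>N. infinite {n. h n = N}"] by auto
  then show ?thesis using finite_below by (meson not_le)
qed

lemma bLc_ordIso:
  fixes b :: "nat \<Rightarrow> 'a set" and h :: "nat \<Rightarrow> nat"
  assumes big: "\<And>n. |{..<h n}| <o |b n|" and inf: "infinite {n. h n = N}"
    and ge: "\<forall>\<^sub>\<infinity>n. N \<le> h n"
  shows "bLc b h =o |{..<N + 1}|"
proof -
  let ?U = "{F. F \<subseteq> prod_seq b \<and> \<not> (\<exists>\<phi>\<in>slaloms b h. \<forall>x\<in>F. x \<in>\<^sup>* \<phi>)}"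
  obtain X where X: "range X \<subseteq> prod_seq b"
    "\<And>\<phi>. \<phi> \<in> slaloms b h \<Longrightarrow>
      finite {f :: nat \<Rightarrow> bool. X f \<in>\<^sup>* \<phi>} \<and> card {f. X f \<in>\<^sup>* \<phi>} \<le> N"
    using family_finitely_localized[OF big inf] by blast
  obtain I :: "(nat \<Rightarrow> bool) set" where I: "finite I" "card I = N + 1"
    using infinite_arbitrarily_large[OF infinite_UNIV_nat_bool] by blast
  \<comment> \<open>Indices \<open>f\<close> are counted rather than functions \<open>X f\<close>,
    so possible coincidences among the latter do no harm.\<close>
  have "\<not> (\<forall>x\<in>X ` I. x \<in>\<^sup>* \<phi>)" if "\<phi> \<in> slaloms b h" for \<phi>
  proof
    assume "\<forall>x\<in>X ` I. x \<in>\<^sup>* \<phi>"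
    then have "I \<subseteq> {f. X f \<in>\<^sup>* \<phi>}" by blast
    then have "N + 1 \<le> N" using X(2)[OF that] I by (metis card_mono le_trans)
    then show False by simp
  qed
  then have XI: "X ` I \<in> ?U" using X(1) by blast
  then have ne: "?U \<noteq> {}" by blast
  have "|I| =o |{..<N + 1}|" using I by (simp add: ordIso_iff_ordLeq card_of_ordLeq_iff_card_le)
  then have "bLc b h \<le>o |{..<N + 1}|"
    unfolding bLc_def using least_size(2)[OF ne] XI card_of_image[of X I]
    by (meson ordLeq_ordIso_trans ordLeq_transitive)
  \<comment> \<open>A smaller \<open>F\<close> has at most \<open>N\<close> elements, hence at most
    \<open>h n\<close> for almost all \<open>n\<close>, and is localized by one slalom.\<close>
  moreover have "|{..<N + 1}| \<le>o |F|" if "F \<in> ?U" for F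
  proof (rule ccontr)
    assume "\<not> |{..<N + 1}| \<le>o |F|"
    then have less: "|F| <o |{..<N + 1}|" by (metis card_of_Well_order ordLess_or_ordLeq)
    then have fin: "finite F" using card_of_ordLeq_finite ordLess_imp_ordLeq by blast
    then have "card F < N + 1" 
      using less not_ordLess_ordLeq card_of_ordLeq_iff_card_le[of "{..<N + 1}" F] by fastforce
    with ge have "\<forall>\<^sub>\<infinity>n. card F \<le> h n" by (auto elim: eventually_mono)
    with localized_if_card_le fin that show False by blast
  qed
  moreover obtain F where "F \<in> ?U" "bLc b h = |F|"
    unfolding bLc_def using least_size(1)[OF ne] by blast
  ultimately show ?thesis by (simp only: ordIso_iff_ordLeq)
qed

theorem theorem3p12:
  fixes b :: "nat \<Rightarrow> 'a set" and h :: "nat \<Rightarrow> nat"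
  assumes "\<And>n. b n \<noteq> {}"
    and "\<And>n. 0 < h n"
    and "\<And>n. |{..<h n}| <o |b n|"
    and "\<not> filterlim h at_top sequentially"
  shows "continuum \<le>o dLc b h
    \<and> (\<exists>N. infinite {n. h n = N} \<and> (\<forall>M. infinite {n. h n = M} \<longrightarrow> N \<le> M)
          \<and> bLc b h =o |{..<N + 1}| )
    \<and> ((\<forall>\<^sub>\<infinity>n. |b n| \<le>o continuum) \<longrightarrow> dLc b h =o continuum)"
proof -
  obtain N where N: "infinite {n. h n = N}" "\<forall>M. infinite {n. h n = M} \<longrightarrow> N \<le> M"
    "\<forall>\<^sub>\<infinity>n. N \<le> h n"
    using least_infinite_fibre[OF assms(4)] by blast
  let ?L = "{D. D \<subseteq> slaloms b h \<and> (\<forall>x\<in>prod_seq b. \<exists>\<phi>\<in>D. x \<in>\<^sup>* \<phi>)}"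
  have "slaloms b h \<in> ?L" using dLc_family_nonempty[OF assms(2), of b] by simp
  then have ne: "?L \<noteq> {}" by blast
  obtain D where D: "D \<in> ?L" "dLc b h = |D|" unfolding dLc_def using least_size(1)[OF ne] by blast
  have lower: "continuum \<le>o dLc b h"
    using localizing_family_ge_continuum[OF assms(3) N(1)] D by auto
  have upper: "dLc b h \<le>o continuum" if small: "\<forall>\<^sub>\<infinity>n. |b n| \<le>o continuum"
  proof -
    obtain E where E: "E \<subseteq> slaloms b h" "\<forall>x\<in>prod_seq b. \<exists>\<phi>\<in>E. x \<in>\<^sup>* \<phi>" "|E| \<le>o continuum"
      using localizing_family_le_continuum[of b h] assms(1,2) small by auto
    then have "dLc b h \<le>o |E|" unfolding dLc_def using least_size(2)[OF ne] by simp
    then show ?thesis using E(3) by (rule ordLeq_transitive)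
  qed
  show ?thesis
  proof (intro conjI impI exI)
    show "dLc b h =o continuum" if "\<forall>\<^sub>\<infinity>n. |b n| \<le>o continuum"
      using lower upper[OF that] by (simp only: ordIso_iff_ordLeq)
  qed (fact lower N(1,2) bLc_ordIso[OF assms(3) N(1,3)])+
qed

end
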